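(* For all integers $n>0$, $t\ge 0$ and $1\le k\le n+1$, $$P(n+1,t,k)=\sum_{j\ge k-1}P(n,t,j)+\sum_{j\le k-2}P(n,t-1,j),$$ where $P(n,t,j)$ is interpreted as $0$ when $j\notin\{1,\dots,n\}$ or $t<0$.
   Context: Multi-pass stack sorting: in a pass, the entries of the current input are pushed one at a time, in order, onto a stack; whenever the top of the stack is the smallest value not yet output, it is popped to the output (repeatedly); entries are never popped otherwise. When all input entries have been pushed and no pop is possible, if the stack is nonempty the remaining entries are returned to the input in their original relative order and a new pass begins. The tier of a permutation is one less than the minimum number of passes needed to output $1,\dots,n$. For $n>0$, $t\ge 0$, $1\le k\le n$, $P(n,t,k)$ is the number of permutations of length $n$ with tier $t$ whose entry $1$ is in position $k$ (positions counted from the left). *)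

theory Defs
  imports Main "HOL-Combinatorics.Multiset_Permutations"
begin

text \<open>
  Permutations of length \<open>n\<close> are words, i.e. elements of \<^term>\<open>permutations_of_set {1..n}\<close>.
  Stacks are lists with the top at the head; the output is a list in order of appearance.
\<close>

definition smallest_missing :: "nat list \<Rightarrow> nat" where
  "smallest_missing out = (LEAST v. 1 \<le> v \<and> v \<notin> set out)"

fun pop_stack :: "nat list \<Rightarrow> nat list \<Rightarrow> nat list \<times> nat list" where
  "pop_stack out [] = (out, [])"
| "pop_stack out (x # stack) =
     (if x = smallest_missing out then pop_stack (out @ [x]) stack else (out, x # stack))"

fun push_all :: "nat list \<Rightarrow> nat list \<Rightarrow> nat list \<Rightarrow> nat list \<times> nat list" where
  "push_all out stack [] = (out, stack)"
| "push_all out stack (x # input) =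
     (let (out', stack') = pop_stack out (x # stack) in push_all out' stack' input)"

text \<open>
  A pass maps a pair (output so far, current input) to the next such pair. Read from bottom to
  top, the stack lists the remaining entries in their original relative order, hence the \<^const>\<open>rev\<close>.
\<close>

definition sort_pass :: "nat list \<times> nat list \<Rightarrow> nat list \<times> nat list" where
  "sort_pass = (\<lambda>(out, input). let (out', stack) = push_all out [] input in (out', rev stack))"

definition passes_needed :: "nat list \<Rightarrow> nat" where
  "passes_needed p = (LEAST r. fst ((sort_pass ^^ r) ([], p)) = [1..<Suc (length p)])"

definition tier :: "nat list \<Rightarrow> nat" where
  "tier p = passes_needed p - 1"

text \<open>
  The arguments \<open>t\<close> and \<open>k\<close> are integers so that \<open>P n t k = 0\<close> whenever \<open>t < 0\<close> or
  \<open>k \<notin> {1..n}\<close>. Positions are counted from 1, list indices from 0.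
\<close>

definition P :: "nat \<Rightarrow> int \<Rightarrow> int \<Rightarrow> nat" where
  "P n t k = card {p \<in> permutations_of_set {1..n}.
      int (tier p) = t \<and> 1 \<le> k \<and> k \<le> int n \<and> p ! nat (k - 1) = 1}"

end

theory Submission
  imports Defs
begin

text \<open>
  Write a permutation of \<open>{1..n+1}\<close> with entry 1 in position \<open>k\<close> as the result of inserting 1 into
  the lift of a permutation \<open>q\<close> of \<open>{1..n}\<close>, whose entry 1 is in position \<open>j\<close>. Sorting \<open>q\<close> and
  sorting its lift with 1 already output run in parallel. If \<open>j \<ge> k - 1\<close>, then 2 is pushed after 1
  or is on top of the stack when 1 is popped, so the first pass already agrees with the first pass
  on \<open>q\<close>. If \<open>j \<le> k - 2\<close>, then 2 is buried when 1 is popped, so the first pass outputs only 1 and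
  one extra pass is needed.
\<close>

text \<open>Sends a state of sorting a word to the state of sorting its lift in which 1 is already
  out.\<close>

definition shift_state :: "nat list \<times> nat list \<Rightarrow> nat list \<times> nat list" where
  "shift_state = map_prod (\<lambda>out. 1 # map Suc out) (map Suc)"

text \<open>\<open>i\<close> is a list index: for \<open>i \<le> length q\<close> the new 1 is in
  position \<open>i + 1\<close>.\<close>

definition insert_one :: "nat \<Rightarrow> nat list \<Rightarrow> nat list" where
  "insert_one i q = take i (map Suc q) @ 1 # drop i (map Suc q)"

text \<open>\<open>passes_needed p\<close> is the least such \<open>r\<close>; as a predicate in
  \<open>r\<close> it can be compared between two words before minima are taken.\<close>

definition sorted_after :: "nat list \<Rightarrow> nat \<Rightarrow> bool" where
  "sorted_after p r \<longleftrightarrow> fst ((sort_pass ^^ r) ([], p)) = [1..<Suc (length p)]"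

section \<open>Passes commute with the shift\<close>

lemma smallest_missing_Nil: "smallest_missing [] = 1"
  unfolding smallest_missing_def by (rule Least_equality) auto

lemma smallest_missing_props:
  "1 \<le> smallest_missing out" "smallest_missing out \<notin> set out"
proof -
  \<comment> \<open>Including 0 in the avoided finite set makes the fresh value positive, so the
    \<open>LEAST\<close> is attained.\<close>
  obtain v where "v \<notin> insert 0 (set out)"
    by (meson List.finite_set ex_new_if_finite finite_insert infinite_UNIV_nat)
  then have "1 \<le> v \<and> v \<notin> set out" by auto
  then have "1 \<le> smallest_missing out \<and> smallest_missing out \<notin> set out"
    unfolding smallest_missing_def by (rule LeastI)
  then show "1 \<le> smallest_missing out" "smallest_missing out \<notin> set out" by auto
qed

lemma smallest_missing_le: "1 \<le> v \<Longrightarrow> v \<notin> set out \<Longrightarrow> smallest_missing out \<le> v"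
  unfolding smallest_missing_def by (rule Least_le) auto

text \<open>As 1 is present, the positive values missing from the lifted output are exactly the
  successors of those missing from \<open>out\<close>.\<close>

lemma smallest_missing_shift:
  "smallest_missing (1 # map Suc out) = Suc (smallest_missing out)"
proof (rule antisym)
  show "smallest_missing (1 # map Suc out) \<le> Suc (smallest_missing out)"
    using smallest_missing_props[of out] by (intro smallest_missing_le) auto
next
  let ?v = "smallest_missing (1 # map Suc out)"
  have v: "1 \<le> ?v" "?v \<notin> set (1 # map Suc out)"
    by (rule smallest_missing_props)+
  then have "?v \<noteq> 1" by auto
  with v(1) obtain u where u: "?v = Suc u" "1 \<le> u"
    by (cases ?v) auto
  then have "u \<notin> set out" using v(2) by auto
  then show "Suc (smallest_missing out) \<le> ?v"
    using u smallest_missing_le by auto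
qed

lemma pop_stack_shift:
  "pop_stack (1 # map Suc out) (map Suc stack) = shift_state (pop_stack out stack)"
proof (induction out stack rule: pop_stack.induct)
  case (1 out)
  then show ?case by (simp add: shift_state_def)
next
  case (2 out x stack)
  then show ?case
    using smallest_missing_shift[of out] by (auto simp: shift_state_def)
qed

lemma push_all_shift:
  "push_all (1 # map Suc out) (map Suc stack) (map Suc input)
     = shift_state (push_all out stack input)"
proof (induction input arbitrary: out stack)
  case Nil
  then show ?case by (simp add: shift_state_def)
next
  case (Cons x input)
  obtain out' stack' where "pop_stack out (x # stack) = (out', stack')"
    by fastforce
  then show ?case
    using pop_stack_shift[of out "x # stack"] Cons[of out' stack']
    by (simp add: shift_state_def del: pop_stack.simps)
qed

text \<open>Popping only tests equality with the smallest missing value, and both sides of that test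
  grow by one.\<close>

lemma sort_pass_shift: "sort_pass (shift_state s) = shift_state (sort_pass s)"
proof (cases s)
  case (Pair out input)
  then show ?thesis
    using push_all_shift[of out "[]" input]
    by (simp add: sort_pass_def shift_state_def rev_map split: prod.splits)
qed

lemma sort_pass_funpow_shift:
  "(sort_pass ^^ r) (shift_state s) = shift_state ((sort_pass ^^ r) s)"
  by (induction r) (simp_all add: sort_pass_shift)

section \<open>The first pass after inserting 1\<close>

lemma push_all_append_no_pop:
  "smallest_missing out \<notin> set xs \<Longrightarrow>
     push_all out stack (xs @ ys) = push_all out (rev xs @ stack) ys"
  by (induction xs arbitrary: stack) auto

text \<open>Without 0 in \<open>q\<close> the lift contains no 1, so the prefix is merely stacked.
  The inserted 1 then leaves at once, and popping continues into the reversed prefix.\<close>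

lemma push_all_insert_one:
  "push_all [] [] (insert_one i q)
     = (let (out, stack) = pop_stack [1] (rev (take i (map Suc q)))
        in push_all out stack (drop i (map Suc q)))"
  if "0 \<notin> set q"
proof -
  have "smallest_missing [] \<notin> set (take i (map Suc q))"
    using that by (auto simp: smallest_missing_Nil dest: in_set_takeD)
  then show ?thesis
    unfolding insert_one_def
    by (simp add: push_all_append_no_pop smallest_missing_Nil)
qed

lemma smallest_missing_one: "smallest_missing [1] = 2"
  using smallest_missing_shift[of "[]"] by (simp add: smallest_missing_Nil)

lemma sort_pass_insert_one_buried:
  assumes "0 \<notin> set q" "distinct q" "i \<le> length q" "1 \<in> set (take (i - 1) q)"
  shows "sort_pass ([], insert_one i q) = shift_state ([], q)"
proof -
  let ?pre = "take i (map Suc q)" and ?post = "drop i (map Suc q)"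
  \<comment> \<open>The prefix is nonempty because its first \<open>i - 1\<close> entries already
    include 2. Its last entry \<open>b\<close> is on top of the stack when 1 leaves.\<close>
  obtain a b where ab: "?pre = a @ [b]"
    using assms(3,4) by (cases ?pre rule: rev_cases) auto
  have "a = butlast ?pre" using ab by simp
  also have "\<dots> = map Suc (take (i - 1) q)"
    using assms(3) by (simp add: butlast_take take_map flip: map_butlast)
  finally have "2 \<in> set a" using assms(4) by force
  moreover have "distinct (a @ [b] @ ?post)"
    using assms(2) by (metis ab append.assoc append_take_drop_id distinct_map inj_Suc inj_on_subset
        subset_UNIV)
  \<comment> \<open>The only 2 is in \<open>a\<close>, below \<open>b\<close>: nothing follows 1 to
    the output, and pushing the suffix triggers no pop either.\<close>
  ultimately have "b \<noteq> 2" "2 \<notin> set ?post" by auto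
  then have "push_all [] [] (insert_one i q) = ([1], rev ?post @ rev ?pre)"
    using push_all_insert_one[OF assms(1), of i] ab
      push_all_append_no_pop[of "[1]" ?post "rev ?pre" "[]"]
    by (simp add: smallest_missing_one[simplified])
  then show ?thesis
    by (simp add: sort_pass_def shift_state_def flip: rev_append)
qed

text \<open>Having 1 out from the start could only allow earlier pops of 2 and its successors. With
  2 absent from all but the last prefix entry, such pops begin no earlier than at that entry, where
  1 comes out anyway.\<close>

lemma sort_pass_insert_one_exposed:
  assumes "0 \<notin> set q" "i \<le> length q" "1 \<notin> set (take (i - 1) q)"
  shows "sort_pass ([], insert_one i q) = sort_pass (shift_state ([], q))"
proof -
  let ?pre = "take i (map Suc q)" and ?post = "drop i (map Suc q)"
  have "push_all [1] [] (?pre @ ?post)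
          = (let (out, stack) = pop_stack [1] (rev ?pre) in push_all out stack ?post)"
  proof (cases ?pre rule: rev_cases)
    case Nil
    show ?thesis unfolding Nil by simp
  next
    case (snoc a b)
    then have "a = butlast ?pre" by simp
    also have "\<dots> = map Suc (take (i - 1) q)"
      using assms(2) by (simp add: butlast_take take_map flip: map_butlast)
    finally have "2 \<notin> set a" using assms(3) by auto
    then show ?thesis
      unfolding snoc
      \<comment> \<open>With 1 out, \<open>a\<close> is stacked without pops; pushing
        \<open>b\<close> then runs \<open>pop_stack\<close> on the very stack that is met after 1
        leaves.\<close>
      using push_all_append_no_pop[of "[1]" a "[]" "b # ?post"]
      by (simp add: smallest_missing_one[simplified])
  qed
  then show ?thesis
    using push_all_insert_one[OF assms(1), of i]
    by (simp add: sort_pass_def shift_state_def)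
qed

section \<open>Comparing numbers of passes\<close>

lemma length_insert_one [simp]: "length (insert_one i q) = Suc (length q)"
  by (simp add: insert_one_def)

lemma fst_shift_state_sorted:
  "fst (shift_state s) = [1..<Suc (Suc m)] \<longleftrightarrow> fst s = [1..<Suc m]"
proof -
  have "[1..<Suc (Suc m)] = 1 # map Suc [1..<Suc m]"
    by (simp add: map_Suc_upt upt_conv_Cons del: upt_Suc)
  then show ?thesis
    by (simp add: shift_state_def inj_map_eq_map del: upt_Suc)
qed

lemma sorted_after_insert_one_buried:
  assumes "0 \<notin> set q" "distinct q" "i \<le> length q" "1 \<in> set (take (i - 1) q)"
  shows "sorted_after (insert_one i q) (Suc r) \<longleftrightarrow> sorted_after q r"
  using fst_shift_state_sorted[of "(sort_pass ^^ r) ([], q)" "length q"]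
  by (simp add: sorted_after_def funpow_Suc_right sort_pass_insert_one_buried[OF assms]
      sort_pass_funpow_shift del: upt_Suc funpow.simps)

text \<open>The two runs merge only through the first pass, hence \<open>Suc r\<close> on both
  sides.\<close>

lemma sorted_after_insert_one_exposed:
  assumes "0 \<notin> set q" "i \<le> length q" "1 \<notin> set (take (i - 1) q)"
  shows "sorted_after (insert_one i q) (Suc r) \<longleftrightarrow> sorted_after q (Suc r)"
  using fst_shift_state_sorted[of "(sort_pass ^^ Suc r) ([], q)" "length q"]
  by (simp add: sorted_after_def funpow_Suc_right sort_pass_insert_one_exposed[OF assms]
      sort_pass_funpow_shift sort_pass_shift del: upt_Suc funpow.simps)

lemma not_sorted_after_0: "p \<noteq> [] \<Longrightarrow> \<not> sorted_after p 0"
  by (simp add: sorted_after_def Suc_le_eq)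

section \<open>Inserting and deleting the entry 1\<close>

lemma insert_one_permutation:
  assumes "q \<in> permutations_of_set {1..n}"
  shows "insert_one i q \<in> permutations_of_set {1..n + 1}"
proof (rule permutations_of_setI)
  note q = permutations_of_setD[OF assms]
  have "set (insert_one i q) = insert 1 (set (take i (map Suc q) @ drop i (map Suc q)))"
    unfolding insert_one_def by (simp del: append_take_drop_id)
  also have "\<dots> = insert 1 (Suc ` {1..n})"
    unfolding append_take_drop_id using q(1) by simp
  also have "\<dots> = {1..n + 1}"
    by (auto simp: image_Suc_atLeastAtMost)
  finally show "set (insert_one i q) = {1..n + 1}" .
  have "distinct (take i (map Suc q) @ drop i (map Suc q))"
    unfolding append_take_drop_id using q(2) by (simp add: distinct_map)
  moreover have "1 \<notin> set (take i (map Suc q) @ drop i (map Suc q))"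
    unfolding append_take_drop_id using q(1) by auto
  ultimately show "distinct (insert_one i q)"
    unfolding insert_one_def by (simp del: append_take_drop_id)
qed

lemma nth_insert_one: "i \<le> length q \<Longrightarrow> insert_one i q ! i = 1"
  by (simp add: insert_one_def nth_append)

text \<open>Both prefixes have length \<open>i\<close>, so the equation splits at the inserted
  1.\<close>

lemma insert_one_inject:
  assumes "i \<le> length q" "i \<le> length q'" "insert_one i q = insert_one i q'"
  shows "q = q'"
proof -
  from assms have "take i (map Suc q) = take i (map Suc q')" "drop i (map Suc q) = drop i (map Suc q')"
    unfolding insert_one_def by (auto simp: append_eq_append_conv)
  then have "map Suc q = map Suc q'" by (metis append_take_drop_id)
  then show "q = q'" by (simp add: inj_map_eq_map)
qed

lemma permutation_eq_insert_one:
  assumes "p \<in> permutations_of_set {1..n + 1}" "i \<le> n" "p ! i = 1"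
  obtains q where "q \<in> permutations_of_set {1..n}" "p = insert_one i q"
proof -
  note p = permutations_of_setD[OF assms(1)]
  have len: "length p = n + 1"
    using length_finite_permutations_of_set[OF assms(1)] by simp
  define w where "w = take i p @ drop (Suc i) p"
  define q where "q = map (\<lambda>x. x - 1) w"
  have split: "p = take i p @ 1 # drop (Suc i) p"
    using id_take_nth_drop[of i p] assms(2,3) len by simp
  then have "distinct (take i p @ 1 # drop (Suc i) p)" "set (take i p @ 1 # drop (Suc i) p) = {1..n+1}"
    using p by simp_all
  then have w: "distinct w" "1 \<notin> set w" "insert 1 (set w) = {1..n + 1}"
    unfolding w_def by auto
  then have "set w = {1..n + 1} - {1}"
    by blast
  also have "\<dots> = {2..n + 1}"
    by auto
  finally have set_w: "set w = {2..n + 1}" .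
  \<comment> \<open>\<open>Suc\<close> undoes the truncated subtraction, since all entries of
    \<open>w\<close> are at least 2.\<close>
  have Suc_q: "map Suc q = w"
    unfolding q_def using set_w by (auto intro!: map_idI)
  have "Suc ` set q = {2..n + 1}" using Suc_q set_w by (metis list.set_map)
  also have "\<dots> = Suc ` {1..n}" by (simp add: image_Suc_atLeastAtMost)
  finally have "set q = {1..n}" by (simp only: inj_image_eq_iff[OF inj_Suc])
  moreover have "distinct q" using w(1) unfolding Suc_q[symmetric] distinct_map by simp
  ultimately have "q \<in> permutations_of_set {1..n}" by (rule permutations_of_setI)
  moreover have "p = insert_one i q"
    unfolding insert_one_def Suc_q using split len assms(2) by (simp add: w_def)
  ultimately show thesis by (rule that)
qed

section \<open>Termination and the tier\<close>

lemma ex_sorted_after: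
  "p \<in> permutations_of_set {1..n} \<Longrightarrow> \<exists>r. sorted_after p (Suc r)"
proof (induction n arbitrary: p)
  case 0
  then have "sorted_after p (Suc 0)"
    by (simp add: sorted_after_def sort_pass_def)
  then show ?case ..
next
  case (Suc n)
  have len: "length p = Suc n"
    using length_finite_permutations_of_set[OF Suc.prems] by simp
  have "1 \<in> set p" using permutations_of_setD(1)[OF Suc.prems] by simp
  then obtain i where i: "i \<le> n" "p ! i = 1"
    using len by (metis in_set_conv_nth less_Suc_eq_le)
  obtain q where q: "q \<in> permutations_of_set {1..n}" "p = insert_one i q"
    using permutation_eq_insert_one[of p n i] Suc.prems i by auto
  have props: "0 \<notin> set q" "distinct q" "i \<le> length q"
    using permutations_of_setD[OF q(1)] length_finite_permutations_of_set[OF q(1)] i by auto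
  \<comment> \<open>Restoring 1 costs one more pass if 2 is buried and none otherwise, so finitely
    many passes still suffice.\<close>
  from Suc.IH[OF q(1)] show ?case
    using sorted_after_insert_one_buried[OF props] sorted_after_insert_one_exposed[OF props(1,3)] q(2)
    by blast
qed

text \<open>A nonempty word is not sorted after 0 passes, so the minimum may be taken over
  successors; termination supplies the witness. Hence the subtraction in \<open>tier\<close> is
  exact.\<close>

lemma passes_needed_Suc:
  assumes "p \<in> permutations_of_set {1..n}" "n > 0"
  shows "passes_needed p = Suc (LEAST r. sorted_after p (Suc r))"
proof -
  have "p \<noteq> []" using permutations_of_setD(1)[OF assms(1)] assms(2) by auto
  moreover obtain r where "sorted_after p (Suc r)"
    using ex_sorted_after[OF assms(1)] by blast
  ultimately show ?thesis
    unfolding passes_needed_def sorted_after_def[symmetric]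
    by (intro Least_Suc not_sorted_after_0)
qed

lemma tier_insert_one:
  assumes "q \<in> permutations_of_set {1..n}" "n > 0" "i \<le> n"
  shows "tier (insert_one i q) = (if 1 \<in> set (take (i - 1) q) then Suc (tier q) else tier q)"
proof -
  have props: "0 \<notin> set q" "distinct q" "i \<le> length q"
    using permutations_of_setD[OF assms(1)] length_finite_permutations_of_set[OF assms(1)] assms(3)
    by auto
  have tier_p: "tier (insert_one i q) = (LEAST r. sorted_after (insert_one i q) (Suc r))"
    using passes_needed_Suc[OF insert_one_permutation[OF assms(1)]] by (simp add: tier_def)
  have "passes_needed q = (LEAST r. sorted_after q r)"
    by (simp add: passes_needed_def sorted_after_def)
  \<comment> \<open>The first minimum gives the tier of the insertion in the buried case, the second
    in the exposed case.\<close>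
  then have "(LEAST r. sorted_after q r) = Suc (tier q)" "(LEAST r. sorted_after q (Suc r)) = tier q"
    using passes_needed_Suc[OF assms(1,2)] by (simp_all add: tier_def)
  then show ?thesis
    using sorted_after_insert_one_buried[OF props] sorted_after_insert_one_exposed[OF props(1,3)]
    by (simp add: tier_p)
qed

section \<open>Summing over the position of 1\<close>

lemma P_eq_0: "j < 1 \<Longrightarrow> P n t j = 0"
  by (simp add: P_def)

lemma sum_if_mem_split:
  fixes f g :: "'a \<Rightarrow> 'b :: comm_monoid_add"
  assumes "finite S" "D \<subseteq> S"
  shows "(\<Sum>j\<in>S. if j \<in> D then f j else g j) = sum f D + sum g (S - D)"
  using assms by (simp add: sum.If_cases Int_absorb1 Diff_eq)

theorem theorem4p9:
  fixes n :: nat and t k :: int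
  assumes "n > 0" and "t \<ge> 0" and "1 \<le> k" and "k \<le> int n + 1"
  shows "P (n + 1) t k = (\<Sum>j\<in>{k - 1..int n}. P n t j) + (\<Sum>j\<in>{1..k - 2}. P n (t - 1) j)"
proof -
  define i where "i = nat (k - 1)"
  have i: "i \<le> n" using assms by (simp add: i_def)
  \<comment> \<open>Insertion at \<open>i\<close> maps \<open>B\<close> bijectively onto the
    permutations counted by \<open>P (n + 1) t k\<close>; \<open>C j\<close> is the part of
    \<open>B\<close> with 1 in position \<open>j\<close>.\<close>
  define B where "B = {q \<in> permutations_of_set {1..n}. int (tier (insert_one i q)) = t}"
  define C where "C j = {q \<in> B. q ! nat (j - 1) = 1}" for j :: int
  have len: "length q = n" if "q \<in> permutations_of_set {1..n}" for q
    using length_finite_permutations_of_set[OF that] by simp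
  have A: "{p \<in> permutations_of_set {1..n + 1}.
      int (tier p) = t \<and> 1 \<le> k \<and> k \<le> int (n + 1) \<and> p ! nat (k - 1) = 1} = insert_one i ` B"
    (is "?A = _")
  proof
    show "?A \<subseteq> insert_one i ` B"
    proof
      fix p assume p: "p \<in> ?A"
      then obtain q where "q \<in> permutations_of_set {1..n}" "p = insert_one i q"
        using permutation_eq_insert_one[of p n i] i by (auto simp: i_def)
      with p show "p \<in> insert_one i ` B" by (auto simp: B_def)
    qed
    show "insert_one i ` B \<subseteq> ?A"
      using insert_one_permutation[of _ n i] nth_insert_one[of i] len i assms(3,4)
      by (auto simp: B_def i_def)
  qed
  have "inj_on (insert_one i) B"
    using insert_one_inject[of i] len i by (intro inj_onI) (auto simp: B_def)
  then have "P (n + 1) t k = card B"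
    unfolding P_def A by (rule card_image)
  also have "B = (\<Union>j\<in>{1..int n}. C j)"
  proof
    show "B \<subseteq> (\<Union>j\<in>{1..int n}. C j)"
    proof
      fix q assume q: "q \<in> B"
      then have perm: "q \<in> permutations_of_set {1..n}" by (simp add: B_def)
      then have "1 \<in> set q" using permutations_of_setD(1)[OF perm] assms(1) by simp
      then obtain m where "m < n" "q ! m = 1"
        using len[OF perm] by (metis in_set_conv_nth)
      then have "q \<in> C (int m + 1)" "int m + 1 \<in> {1..int n}"
        using q by (auto simp: C_def)
      then show "q \<in> (\<Union>j\<in>{1..int n}. C j)" by blast
    qed
  qed (auto simp: C_def)
  also have "card \<dots> = (\<Sum>j\<in>{1..int n}. card (C j))"
  proof (rule card_UN_disjoint)
    show "\<forall>j\<in>{1..int n}. finite (C j)" by (simp add: C_def B_def)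
    show "\<forall>j\<in>{1..int n}. \<forall>l\<in>{1..int n}. j \<noteq> l \<longrightarrow> C j \<inter> C l = {}"
    proof (intro ballI impI equals0I)
      fix j l q assume jl: "j \<in> {1..int n}" "l \<in> {1..int n}" "j \<noteq> l" "q \<in> C j \<inter> C l"
      then have perm: "q \<in> permutations_of_set {1..n}" by (simp add: C_def B_def)
      have "q ! nat (j - 1) = q ! nat (l - 1)" using jl by (simp add: C_def)
      then have "nat (j - 1) = nat (l - 1)"
        using jl(1,2) permutations_of_setD(2)[OF perm] len[OF perm]
        by (subst (asm) nth_eq_iff_index_eq) auto
      with jl show False by auto
    qed
  qed simp
  also have "\<dots> = (\<Sum>j\<in>{1..int n}. if j \<in> {1..k - 2} then P n (t - 1) j else P n t j)"
  proof (rule sum.cong)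
    fix j assume j: "j \<in> {1..int n}"
    \<comment> \<open>Position \<open>j\<close> is index \<open>j - 1\<close>, and
      \<open>i - 1\<close> is \<open>k - 2\<close> for \<open>k \<ge> 2\<close>. For
      \<open>k = 1\<close> truncation gives \<open>i - 1 = 0\<close>, and both sides are
      false.\<close>
    have "1 \<in> set (take (i - 1) q) \<longleftrightarrow> j \<le> k - 2"
      if perm: "q \<in> permutations_of_set {1..n}" and one: "q ! nat (j - 1) = 1" for q
    proof -
      have "1 \<in> set (take (i - 1) q) \<longleftrightarrow> (\<exists>m < i - 1. q ! m = 1)"
        using i len[OF perm] by (auto simp: in_set_conv_nth)
      also have "\<dots> \<longleftrightarrow> nat (j - 1) < i - 1"
      proof
        assume "\<exists>m < i - 1. q ! m = 1"
        then obtain m where m: "m < i - 1" "q ! m = q ! nat (j - 1)" using one by auto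
        then have "m = nat (j - 1)"
          using j i permutations_of_setD(2)[OF perm] len[OF perm]
          by (subst (asm) nth_eq_iff_index_eq) auto
        with m show "nat (j - 1) < i - 1" by simp
      qed (use one in blast)
      also have "\<dots> \<longleftrightarrow> j \<le> k - 2" using j by (auto simp: i_def)
      finally show ?thesis .
    qed
    \<comment> \<open>\<open>Suc (tier q)\<close> equals \<open>t\<close> iff \<open>tier q\<close>
      is \<open>t - 1\<close> as an integer; for \<open>t = 0\<close> the buried classes are thus
      empty.\<close>
    then have "C j = {q \<in> permutations_of_set {1..n}.
        int (tier q) = (if j \<le> k - 2 then t - 1 else t) \<and> 1 \<le> j \<and> j \<le> int n \<and> q ! nat (j - 1) = 1}"
      using j tier_insert_one[OF _ assms(1) i] by (auto simp: C_def B_def)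
    then show "card (C j) = (if j \<in> {1..k - 2} then P n (t - 1) j else P n t j)"
      using j by (simp add: P_def)
  qed simp
  also have "\<dots> = (\<Sum>j\<in>{1..k - 2}. P n (t - 1) j) + (\<Sum>j\<in>{1..int n} - {1..k - 2}. P n t j)"
    using assms(4) by (intro sum_if_mem_split) auto
  \<comment> \<open>The ranges differ only for \<open>k = 1\<close>, where the right one also has
    \<open>j = 0\<close>, contributing 0.\<close>
  also have "(\<Sum>j\<in>{1..int n} - {1..k - 2}. P n t j) = (\<Sum>j\<in>{k - 1..int n}. P n t j)"
    using assms by (intro sum.mono_neutral_left) (auto intro!: P_eq_0)
  finally show ?thesis by simp
qed

end
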